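(* Let $(A,\mu,\alpha)$ be a multiplicative right Hom-alternative algebra over a field $\mathbf{k}$ of characteristic $0$ in which $\alpha$ is surjective, and let $e\in A$ be an idempotent. For $i\in\{0,1\}$ put $$A_e(i\alpha)=\{a\in A : ae=i\,\alpha(a)\},$$ so that $A_e(\alpha)=\{a : ae=\alpha(a)\}$ and $A_e(0)=\{a: ae=0\}$. Then $A_e(\alpha)$ and $A_e(0)$ are sub-Hom-modules of $A$ and there is a (not necessarily direct) sum decomposition $$A=A_e(\alpha)+A_e(0).$$ If $\alpha$ is also injective, then this sum is direct.
   Context: We work over a fixed field $\mathbf{k}$ of characteristic $0$. A Hom-algebra is a triple $(A,\mu,\alpha)$ where $A$ is a $\mathbf{k}$-module, $\mu\colon A^{\otimes 2}\to A$ is bilinear (written $xy=\mu(x,y)$), and $\alpha\colon A\to A$ is linear. It is multiplicative if $\alpha(xy)=\alpha(x)\alpha(y)$ for all $x,y\in A$. It is right Hom-alternative if $(xy)\alpha(y)=\alpha(x)(yy)$ for all $x,y\in A$. An idempotent in $(A,\mu,\alpha)$ is an element $e\in A$ with $e^2=e=\alpha(e)$, where $e^2=\mu(e,e)$. A sub-Hom-module of $A$ is a $\mathbf{k}$-submodule $B\subseteq A$ with $\alpha(B)\subseteq B$. *)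

theory Defs
  imports Complex_Main "HOL-Library.Set_Algebras"
begin

(* The underlying space is the whole type 'a, with the scalar action as a parameter. *)
locale hom_algebra = vector_space scale
  for scale :: "'k::field_char_0 \<Rightarrow> 'a::ab_group_add \<Rightarrow> 'a" +
  fixes \<mu> :: "'a \<Rightarrow> 'a \<Rightarrow> 'a"
    and \<alpha> :: "'a \<Rightarrow> 'a"
  assumes linear_left: "\<And>y. Vector_Spaces.linear scale scale (\<lambda>x. \<mu> x y)"
    and linear_right: "\<And>x. Vector_Spaces.linear scale scale (\<lambda>y. \<mu> x y)"
    and linear_twist: "Vector_Spaces.linear scale scale \<alpha>"

definition multiplicative :: "('a \<Rightarrow> 'a \<Rightarrow> 'a) \<Rightarrow> ('a \<Rightarrow> 'a) \<Rightarrow> bool" where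
  "multiplicative \<mu> \<alpha> \<longleftrightarrow> (\<forall>x y. \<alpha> (\<mu> x y) = \<mu> (\<alpha> x) (\<alpha> y))"

definition right_hom_alternative :: "('a \<Rightarrow> 'a \<Rightarrow> 'a) \<Rightarrow> ('a \<Rightarrow> 'a) \<Rightarrow> bool" where
  "right_hom_alternative \<mu> \<alpha> \<longleftrightarrow> (\<forall>x y. \<mu> (\<mu> x y) (\<alpha> y) = \<mu> (\<alpha> x) (\<mu> y y))"

definition hom_idempotent :: "('a \<Rightarrow> 'a \<Rightarrow> 'a) \<Rightarrow> ('a \<Rightarrow> 'a) \<Rightarrow> 'a \<Rightarrow> bool" where
  "hom_idempotent \<mu> \<alpha> e \<longleftrightarrow> \<mu> e e = e \<and> e = \<alpha> e"

definition sub_hom_module ::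
    "('k::field \<Rightarrow> 'a::ab_group_add \<Rightarrow> 'a) \<Rightarrow> ('a \<Rightarrow> 'a) \<Rightarrow> 'a set \<Rightarrow> bool" where
  "sub_hom_module scale \<alpha> B \<longleftrightarrow> module.subspace scale B \<and> \<alpha> ` B \<subseteq> B"

(* The space A_e(i \<alpha>) = {a. a e = i \<alpha>(a)}; it is used for the scalars i = 1,
   giving A_e(\<alpha>), and i = 0, giving A_e(0). *)
definition peirce_space ::
    "('k \<Rightarrow> 'a \<Rightarrow> 'a) \<Rightarrow> ('a \<Rightarrow> 'a \<Rightarrow> 'a) \<Rightarrow> ('a \<Rightarrow> 'a) \<Rightarrow> 'a \<Rightarrow> 'k \<Rightarrow> 'a set" where
  "peirce_space scale \<mu> \<alpha> e i = {a. \<mu> a e = scale i (\<alpha> a)}"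

(* The canonical map from the external direct sum of B and C to B + C is injective. *)
definition direct_sum_of :: "'a::ab_group_add set \<Rightarrow> 'a set \<Rightarrow> bool" where
  "direct_sum_of B C \<longleftrightarrow> inj_on (\<lambda>(b, c). b + c) (B \<times> C)"

lemma (in hom_algebra) peirce_space_1: "peirce_space scale \<mu> \<alpha> e 1 = {a. \<mu> a e = \<alpha> a}"
  by (simp add: peirce_space_def)

lemma (in hom_algebra) peirce_space_0: "peirce_space scale \<mu> \<alpha> e 0 = {a. \<mu> a e = 0}"
  by (simp add: peirce_space_def)

end

theory Submission
  imports Defs
begin

text \<open>
  Let \<open>R x = \<mu> x e\<close> be right multiplication by the idempotent. Since \<open>\<alpha> e = e\<close>, right
  Hom-alternativity at \<open>y = e\<close> says \<open>R \<circ> R = R \<circ> \<alpha>\<close>, and multiplicativity says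
  \<open>\<alpha> \<circ> R = R \<circ> \<alpha>\<close>. The second relation makes every \<open>peirce_space\<close> stable under \<open>\<alpha>\<close>.
  For the decomposition, \<open>R (R b) = R (\<alpha> b) = \<alpha> (R b)\<close>, so \<open>R b\<close> lies in the space for
  \<open>1\<close>, and \<open>R (\<alpha> b - R b) = 0\<close>, so \<open>\<alpha> b - R b\<close> lies in the space for \<open>0\<close>. Thus
  \<open>\<alpha> b = R b + (\<alpha> b - R b)\<close> decomposes every element in the image of \<open>\<alpha>\<close>, which is
  everything when \<open>\<alpha>\<close> is surjective. An element \<open>a\<close> common to both spaces satisfies
  \<open>\<alpha> a = R a = 0\<close>; hence the intersection lies in the kernel of \<open>\<alpha>\<close>, and the sum is
  direct when \<open>\<alpha>\<close> is injective.
\<close>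

context hom_algebra
begin

lemma subspace_peirce_space: "subspace (peirce_space scale \<mu> \<alpha> e i)"
proof -
  interpret R: Vector_Spaces.linear scale scale "\<lambda>x. \<mu> x e"
    by (rule linear_left)
  interpret T: Vector_Spaces.linear scale scale \<alpha>
    by (rule linear_twist)
  show ?thesis
    by (rule subspaceI)
      (simp_all add: peirce_space_def R.zero T.zero R.add T.add R.scale T.scale
        scale_right_distrib mult.commute)
qed

lemma sub_hom_module_peirce_space:
  assumes "multiplicative \<mu> \<alpha>" and "\<alpha> e = e"
  shows "sub_hom_module scale \<alpha> (peirce_space scale \<mu> \<alpha> e i)"
proof -
  interpret T: Vector_Spaces.linear scale scale \<alpha>
    by (rule linear_twist)
  have "\<mu> (\<alpha> a) e = scale i (\<alpha> (\<alpha> a))" if "\<mu> a e = scale i (\<alpha> a)" for a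
  proof -
    have "\<mu> (\<alpha> a) e = \<alpha> (\<mu> a e)"
      using assms by (simp add: multiplicative_def)
    with that show ?thesis
      by (simp add: T.scale)
  qed
  then have "\<alpha> ` peirce_space scale \<mu> \<alpha> e i \<subseteq> peirce_space scale \<mu> \<alpha> e i"
    by (auto simp: peirce_space_def)
  with subspace_peirce_space show ?thesis
    by (simp add: sub_hom_module_def)
qed

lemma right_mult_idempotent_twice:
  assumes "right_hom_alternative \<mu> \<alpha>" and "hom_idempotent \<mu> \<alpha> e"
  shows "\<mu> (\<mu> x e) e = \<mu> (\<alpha> x) e"
proof -
  have "\<mu> (\<mu> x e) (\<alpha> e) = \<mu> (\<alpha> x) (\<mu> e e)"
    using assms(1) by (simp add: right_hom_alternative_def)
  with assms(2) show ?thesis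
    by (simp add: hom_idempotent_def)
qed

text \<open>
  The relation \<open>\<mu> (\<mu> b e) e = \<mu> (\<alpha> b) e\<close> makes \<open>\<mu> b e\<close> a component of \<open>\<alpha> b\<close> rather
  than of \<open>b\<close>, which is why the inclusion concerns the image of \<open>\<alpha>\<close>. The components
  are built from the chosen preimage \<open>b\<close>.
\<close>

lemma range_twist_subset_peirce_sum:
  assumes "multiplicative \<mu> \<alpha>" and "right_hom_alternative \<mu> \<alpha>"
    and "hom_idempotent \<mu> \<alpha> e"
  shows "range \<alpha> \<subseteq> peirce_space scale \<mu> \<alpha> e 1 + peirce_space scale \<mu> \<alpha> e 0"
proof (rule image_subsetI)
  fix b
  interpret R: Vector_Spaces.linear scale scale "\<lambda>x. \<mu> x e"
    by (rule linear_left)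
  note twice = right_mult_idempotent_twice[OF assms(2,3), of b]
  have "\<mu> (\<alpha> b) e = \<alpha> (\<mu> b e)"
    using assms(1,3) by (simp add: multiplicative_def hom_idempotent_def)
  with twice have "\<mu> b e \<in> peirce_space scale \<mu> \<alpha> e 1"
    by (simp add: peirce_space_1)
  moreover have "\<alpha> b - \<mu> b e \<in> peirce_space scale \<mu> \<alpha> e 0"
    using twice by (simp add: peirce_space_0 R.diff)
  ultimately have "\<mu> b e + (\<alpha> b - \<mu> b e)
      \<in> peirce_space scale \<mu> \<alpha> e 1 + peirce_space scale \<mu> \<alpha> e 0"
    by (rule set_plus_intro)
  then show "\<alpha> b \<in> peirce_space scale \<mu> \<alpha> e 1 + peirce_space scale \<mu> \<alpha> e 0"
    by simp
qed

lemma direct_sum_of_subspaces: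
  assumes "subspace B" and "subspace C" and "B \<inter> C \<subseteq> {0}"
  shows "direct_sum_of B C"
  unfolding direct_sum_of_def
proof (rule inj_onI, clarsimp)
  fix b c b' c'
  assume mem: "b \<in> B" "c \<in> C" "b' \<in> B" "c' \<in> C" and eq: "b + c = b' + c'"
  have diff: "b - b' = c' - c"
    using eq by (simp add: algebra_simps)
  have "b - b' \<in> B \<inter> C"
  proof
    show "b - b' \<in> B"
      using assms(1) mem by (simp add: subspace_diff)
    show "b - b' \<in> C"
      unfolding diff using assms(2) mem by (simp add: subspace_diff)
  qed
  with assms(3) have "b - b' = 0"
    by blast
  with eq show "b = b' \<and> c = c'"
    by simp
qed

lemma peirce_space_Int_subset_0:
  assumes "inj \<alpha>"
  shows "peirce_space scale \<mu> \<alpha> e 1 \<inter> peirce_space scale \<mu> \<alpha> e 0 \<subseteq> {0}"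
proof -
  interpret T: Vector_Spaces.linear scale scale \<alpha>
    by (rule linear_twist)
  have "a = 0" if "\<alpha> a = 0" for a
    using assms that T.zero by (metis injD)
  then show ?thesis
    by (auto simp: peirce_space_1 peirce_space_0)
qed

end

theorem proposition5p5:
  fixes scale :: "'k::field_char_0 \<Rightarrow> 'a::ab_group_add \<Rightarrow> 'a"
    and \<mu> :: "'a \<Rightarrow> 'a \<Rightarrow> 'a"
    and \<alpha> :: "'a \<Rightarrow> 'a"
    and e :: 'a
  assumes "hom_algebra scale \<mu> \<alpha>"
    and "multiplicative \<mu> \<alpha>"
    and "right_hom_alternative \<mu> \<alpha>"
    and "surj \<alpha>"
    and "hom_idempotent \<mu> \<alpha> e"
  shows "sub_hom_module scale \<alpha> (peirce_space scale \<mu> \<alpha> e 1)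
    \<and> sub_hom_module scale \<alpha> (peirce_space scale \<mu> \<alpha> e 0)
    \<and> UNIV = peirce_space scale \<mu> \<alpha> e 1 + peirce_space scale \<mu> \<alpha> e 0
    \<and> (inj \<alpha> \<longrightarrow> direct_sum_of (peirce_space scale \<mu> \<alpha> e 1) (peirce_space scale \<mu> \<alpha> e 0))"
proof -
  interpret hom_algebra scale \<mu> \<alpha>
    by (rule assms(1))
  have "\<alpha> e = e"
    using assms(5) by (simp add: hom_idempotent_def)
  then have sub: "sub_hom_module scale \<alpha> (peirce_space scale \<mu> \<alpha> e i)" for i
    by (rule sub_hom_module_peirce_space[OF assms(2)])
  have sum: "UNIV = peirce_space scale \<mu> \<alpha> e 1 + peirce_space scale \<mu> \<alpha> e 0"
    using range_twist_subset_peirce_sum[OF assms(2,3,5)] assms(4) by auto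
  have direct: "direct_sum_of (peirce_space scale \<mu> \<alpha> e 1) (peirce_space scale \<mu> \<alpha> e 0)"
    if "inj \<alpha>"
    using subspace_peirce_space subspace_peirce_space peirce_space_Int_subset_0[OF that]
    by (rule direct_sum_of_subspaces)
  from sub sum direct show ?thesis
    by blast
qed

end
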